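(* For each positive integer $n$ let $X_n$ be the number of permutations needed for the shuffling-and-merging process started from $[n]$ to end, and let $\mu_n=\mathbf{E}[X_n]$. Define $\varepsilon_n$ by $$\mu_n=n+\mathcal{H}_{n-1}+\varepsilon_n .$$ Then the limit $\lim_{n\to+\infty}\varepsilon_n$ exists. In particular, for every $n\ge 2$, $$0<\varepsilon_n-\varepsilon_{n+1}<\frac{1}{n^2}.$$
   Context: The process. For a positive integer $n$, take a uniformly random permutation $\tau=(\tau(1),\ldots,\tau(n))$ of $[n]=\{1,2,\ldots,n\}$. A block of $\tau$ is a maximal sequence of (increasing) consecutive integers $a,a+1,\ldots,a+r$ ($r\ge 0$) that appear, in this order, in adjacent positions of $\tau$. For example, the blocks of $(1,7,5,6,8,10,9,2,3,4)$ are $(1),(7),(5,6),(8),(10),(9),(2,3,4)$. Each block is merged into its first integer, and after all the merges the elements of the new set are relabeled from $1$ to the current number of elements, giving $[k]$ where $k$ is the number of blocks. One then takes a new, independent, uniformly random permutation of $[k]$, merges again, and so on, until only one integer is left. $X_n$ is the number of permutations used until the process ends; by convention $X_1=0$, so $\mu_1=0$. Equivalently, for $n\ge 2$, $X_n$ has the law of $1+\widetilde X_{Y_n}$, where $Y_n$ is the number of blocks in a uniformly random permutation of $[n]$ and the $\widetilde X_k$ ($1\le k\le n$) are independent of $Y_n$ and of each other, with $\widetilde X_k$ distributed as $X_k$. $\mathcal{H}_n=\sum_{k=1}^n\frac1k$ is the $n$-th harmonic number, with $\mathcal{H}_0=0$. *)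

theory Defs
  imports "HOL-Probability.Probability" "HOL-Library.Sublist"
    "HOL-Combinatorics.Multiset_Permutations"
begin

text \<open>A permutation of \<open>{1..n}\<close> is represented by the list of its values
  \<open>[\<tau>(1), \<dots>, \<tau>(n)]\<close>, an element of \<open>permutations_of_set {1..n}\<close>; \<open>sublist\<close> is the
  contiguous sublist relation.\<close>

definition consecutive_run :: "nat list \<Rightarrow> bool" where
  "consecutive_run xs \<longleftrightarrow> (\<exists>a r. xs = [a..<Suc (a + r)])"

text \<open>The entries of a permutation are distinct, so a list occurs at most once in it as a
  contiguous sublist: distinct occurrences of blocks are distinct as lists.\<close>

definition blocks :: "nat list \<Rightarrow> nat list set" where
  "blocks \<tau> = {xs. consecutive_run xs \<and> sublist xs \<tau> \<and>
     (\<forall>ys. consecutive_run ys \<and> sublist ys \<tau> \<and> sublist xs ys \<longrightarrow> ys = xs)}"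

text \<open>The randomness available in one round: for every \<open>k\<close> a uniformly random permutation of
  \<open>{1..k}\<close>, all independent. A round started from \<open>{1..k}\<close> reads only the one with index \<open>k\<close>.\<close>

definition round_space :: "(nat \<Rightarrow> nat list) measure" where
  "round_space = (\<Pi>\<^sub>M k\<in>UNIV. measure_pmf (pmf_of_set (permutations_of_set {1..k})))"

text \<open>Different rounds are independent.\<close>

definition process_space :: "(nat \<Rightarrow> nat list) stream measure" where
  "process_space = stream_space round_space"

text \<open>\<open>num_left n \<omega> t\<close> is the number of integers left after \<open>t\<close> permutations, starting from
  \<open>{1..n}\<close>. Merging every block into its first integer and relabelling turns \<open>{1..k}\<close> into
  \<open>{1..j}\<close>, where \<open>j\<close> is the number of blocks, so the current set is determined by its size.
  The size \<open>1\<close> is absorbing.\<close>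

primrec num_left :: "nat \<Rightarrow> (nat \<Rightarrow> nat list) stream \<Rightarrow> nat \<Rightarrow> nat" where
  "num_left n \<omega> 0 = n"
| "num_left n \<omega> (Suc t) = card (blocks ((\<omega> !! t) (num_left n \<omega> t)))"

text \<open>The infimum is \<open>\<infinity>\<close> if the process never reaches a single integer.\<close>

definition num_perms :: "nat \<Rightarrow> (nat \<Rightarrow> nat list) stream \<Rightarrow> enat" where
  "num_perms n \<omega> = (INF t\<in>{t. num_left n \<omega> t = 1}. enat t)"

definition mu :: "nat \<Rightarrow> ennreal" where
  "mu n = (\<integral>\<^sup>+ \<omega>. ennreal_of_enat (num_perms n \<omega>) \<partial>process_space)"

end

theory Submission
  imports Defs
begin

text \<open>The number of blocks of a permutation of \<open>{1..m+1}\<close> is \<open>m + 1 - S\<close>, where \<open>S\<close> counts the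
  successions, i.e. the values \<open>y\<close> immediately followed by \<open>y + 1\<close>. Inserting the entry \<open>m + 2\<close>
  changes \<open>S\<close> by at most one, which yields the law of \<open>S\<close>.

  With \<open>d\<^sub>k = \<mu>\<^sub>k\<^sub>+\<^sub>1 - \<mu>\<^sub>k\<close> the recursion \<open>\<mu>\<^sub>m\<^sub>+\<^sub>1 = 1 + E[\<mu>\<^sub>m\<^sub>+\<^sub>1\<^sub>-\<^sub>S]\<close> becomes
  \<open>\<Sum>\<^sub>i d\<^sub>m\<^sub>-\<^sub>i P(S > i) = 1\<close>. Substituting \<open>d\<^sub>k = 1 + 1/k - e\<^sub>k\<close>, where
  \<open>e\<^sub>k = \<epsilon>\<^sub>k - \<epsilon>\<^sub>k\<^sub>+\<^sub>1\<close>, and using \<open>E[S] = m/(m + 1)\<close> gives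
  \<open>\<Sum>\<^sub>i e\<^sub>m\<^sub>-\<^sub>i P(S > i) = \<Sum>\<^sub>i (1/(m - i) - 1/m) P(S > i)\<close>.
  The bounds \<open>0 < e\<^sub>m < 1/m\<^sup>2\<close> follow by strong induction on \<open>m\<close>: for the upper one all
  \<open>e\<^sub>m\<^sub>-\<^sub>i\<close> with \<open>i \<ge> 1\<close> are dropped, for the lower one they are replaced by \<open>1/(m - i)\<^sup>2\<close>. This
  suffices because \<open>S\<close> is nearly Poisson with mean 1: times \<open>m\<^sup>2\<close>, the right-hand side is about
  \<open>E[S(S - 1)]/2 \<approx> 1/2\<close>, which lies between \<open>\<Sum>\<^sub>i\<^sub>\<ge>\<^sub>1 P(S > i) \<approx> 0.37\<close> and
  \<open>P(S > 0) \<approx> 0.63\<close>.\<close>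

section \<open>Blocks counted through successions\<close>

definition successions :: "nat list \<Rightarrow> nat set" where
  "successions \<tau> = {y. sublist [y, Suc y] \<tau>}"

lemma sublist_pair_iff: "sublist [y, z] xs \<longleftrightarrow> (\<exists>as bs. xs = as @ y # z # bs)"
  by (auto simp: sublist_def)

lemma sublist_pair_append:
  "sublist [y, z] (xs @ ys) \<longleftrightarrow>
     sublist [y, z] xs \<or> sublist [y, z] ys \<or> (xs \<noteq> [] \<and> ys \<noteq> [] \<and> last xs = y \<and> hd ys = z)"
    (is "?L \<longleftrightarrow> ?R")
proof
  assume ?L
  then obtain as bs where eq: "xs @ ys = as @ y # z # bs" by (auto simp: sublist_pair_iff)
  then obtain us where "xs = as @ us \<and> us @ ys = y # z # bs \<or> xs @ us = as \<and> ys = us @ y # z # bs"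
    by (auto simp: append_eq_append_conv2)
  then show ?R
  proof (elim disjE conjE)
    assume *: "xs = as @ us" "us @ ys = y # z # bs"
    consider "us = []" | "us = [y]" | vs where "us = y # z # vs"
      using *(2) by (cases us; cases "tl us") auto
    then show ?R
    proof cases
      case 1
      then show ?thesis using * sublist_pair_iff[of y z ys] by (metis append_Nil)
    next
      case 2
      then show ?thesis using * by auto
    next
      case 3
      then show ?thesis using * sublist_pair_iff[of y z xs] by auto
    qed
  qed (auto simp: sublist_pair_iff)
next
  assume ?R
  then consider "sublist [y, z] xs" | "sublist [y, z] ys"
    | "xs \<noteq> []" "ys \<noteq> []" "last xs = y" "hd ys = z" by blast
  then show ?L
  proof cases
    case 3
    then have "xs @ ys = butlast xs @ y # z # tl ys"
      by (metis append.assoc append_Cons append_Nil append_butlast_last_id list.collapse)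
    then show ?thesis unfolding sublist_pair_iff by blast
  qed (auto simp: sublist_append)
qed

lemma sublist_pair_Cons:
  "sublist [y, z] (x # ys) \<longleftrightarrow> sublist [y, z] ys \<or> (ys \<noteq> [] \<and> x = y \<and> hd ys = z)"
  using sublist_pair_append[of y z "[x]" ys] by (auto dest: sublist_length_le)

lemma sublist_pair_mem: "sublist [y, z] xs \<Longrightarrow> y \<in> set xs \<and> z \<in> set xs"
  using set_mono_sublist by fastforce

lemma finite_successions [simp]: "finite (successions \<tau>)"
  by (rule finite_subset[of _ "set \<tau>"]) (auto simp: successions_def dest: sublist_pair_mem)

lemma sublist_run_pair:
  assumes "y \<in> {a..<b}" "Suc y < b"
  shows "sublist [y, Suc y] [a..<b]"
proof -
  have "[a..<b] = [a..<y] @ [y..<b]" using assms upt_add_eq_append[of a y "b - y"] by simp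
  also have "[y..<b] = [y, Suc y] @ [Suc (Suc y)..<b]" using assms by (simp add: upt_conv_Cons)
  finally show ?thesis by (metis sublist_appendI)
qed

text \<open>The entries are distinct, so \<open>Suc y\<close> occurs only once; the pair and the run
  overlap there and glue together.\<close>

lemma sublist_run_extend_left:
  assumes "distinct \<tau>" "sublist [y, Suc y] \<tau>" "sublist [Suc y..<b] \<tau>" "Suc y < b"
  shows "sublist [y..<b] \<tau>"
proof -
  obtain A B where AB: "\<tau> = A @ [y, Suc y] @ B" using assms(2) by (auto simp: sublist_def)
  obtain C D where CD: "\<tau> = C @ [Suc y..<b] @ D" using assms(3) by (auto simp: sublist_def)
  have "C @ Suc y # ([Suc (Suc y)..<b] @ D) = (A @ [y]) @ Suc y # B"
    using AB CD assms(4) by (simp add: upt_conv_Cons)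
  moreover have "Suc y \<notin> set C" "Suc y \<notin> set ([Suc (Suc y)..<b] @ D)"
    using assms(1,4) unfolding CD by (auto simp: upt_conv_Cons)
  ultimately have "C = A @ [y]" using append_Cons_eq_iff by metis
  then have "\<tau> = A @ [y..<b] @ D" using CD assms(4) by (simp add: upt_conv_Cons)
  then show ?thesis by (metis sublist_appendI)
qed

lemma hd_run: "consecutive_run xs \<Longrightarrow> xs \<noteq> [] \<and> xs = [hd xs..<Suc (last xs)] \<and> hd xs \<le> last xs"
  by (auto simp: consecutive_run_def simp del: upt_Suc)

lemma consecutive_runI: "a < b \<Longrightarrow> consecutive_run [a..<b]"
  unfolding consecutive_run_def by (intro exI[of _ a] exI[of _ "b - Suc a"]) auto

text \<open>A run that starts at the second entry of a succession can be prolonged to the left; from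
  any other entry the longest run is maximal.\<close>

lemma hd_blocks:
  assumes "distinct \<tau>"
  shows "hd ` blocks \<tau> = set \<tau> - Suc ` successions \<tau>"
proof (intro equalityI subsetI)
  fix x assume "x \<in> hd ` blocks \<tau>"
  then obtain xs where xs: "xs \<in> blocks \<tau>" "x = hd xs" by auto
  then have run: "consecutive_run xs" "sublist xs \<tau>"
    and mx: "\<And>ys. consecutive_run ys \<Longrightarrow> sublist ys \<tau> \<Longrightarrow> sublist xs ys \<Longrightarrow> ys = xs"
    by (auto simp: blocks_def)
  define b where "b = Suc (last xs)"
  have b: "xs = [x..<b]" "x < b" "xs \<noteq> []" using hd_run[OF run(1)] xs(2) by (auto simp: b_def)
  have "x \<in> set \<tau>" using run(2) b set_mono_sublist by force
  moreover have "x \<notin> Suc ` successions \<tau>"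
  proof
    assume "x \<in> Suc ` successions \<tau>"
    then obtain y where y: "x = Suc y" "sublist [y, Suc y] \<tau>" by (auto simp: successions_def)
    then have "sublist [y..<b] \<tau>" using sublist_run_extend_left[OF assms y(2)] run(2) b by simp
    moreover have "consecutive_run [y..<b]" using b y by (intro consecutive_runI) auto
    moreover have "[y..<b] = [y] @ xs" using b y by (simp add: upt_conv_Cons)
    ultimately have "[y] @ xs = xs" using mx by (metis sublist_append_leftI)
    then show False by simp
  qed
  ultimately show "x \<in> set \<tau> - Suc ` successions \<tau>" by simp
next
  fix x assume x: "x \<in> set \<tau> - Suc ` successions \<tau>"
  let ?P = "\<lambda>r. sublist [x..<Suc (x + r)] \<tau>"
  have P0: "?P 0"
  proof -
    obtain A B where "\<tau> = A @ x # B" using split_list[of x \<tau>] x by auto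
    then have "\<tau> = A @ [x] @ B" by simp
    then have "sublist [x] \<tau>" by (metis sublist_appendI)
    then show ?thesis by simp
  qed
  have bnd: "r \<le> length \<tau>" if "?P r" for r using sublist_length_le[OF that] by (simp del: upt_Suc)
  \<comment> \<open>The longest run starting at \<open>x\<close>. A run containing it must also
    start at \<open>x\<close>: otherwise it would contain \<open>x - 1\<close> just before
    \<open>x\<close>, a succession excluded by the choice of \<open>x\<close>.\<close>
  obtain r where r: "?P r" and rmax: "\<And>r'. ?P r' \<Longrightarrow> r' \<le> r"
    using GreatestI_nat[of ?P 0 "length \<tau>", OF P0 bnd] Greatest_le_nat[of ?P _ "length \<tau>", OF _ bnd]
    by (rule that)
  define xs where "xs = [x..<Suc (x + r)]"
  have ne: "xs \<noteq> []" "hd xs = x" by (auto simp: xs_def simp del: upt_Suc)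
  have "ys = xs" if ys: "consecutive_run ys" "sublist ys \<tau>" "sublist xs ys" for ys
  proof -
    obtain a q where aq: "ys = [a..<Suc (a + q)]" using ys(1) by (auto simp: consecutive_run_def)
    have xin: "x \<in> set ys" using set_mono_sublist[OF ys(3)] ne by (metis hd_in_set subsetD)
    have "x = a"
    proof (rule ccontr)
      assume "x \<noteq> a"
      then obtain y where y: "x = Suc y" "a \<le> y" using xin aq by (cases x) auto
      then have "sublist [y, Suc y] ys" unfolding aq using xin aq by (intro sublist_run_pair) auto
      then have "sublist [y, Suc y] \<tau>" using ys(2) sublist_order.order_trans by blast
      then show False using x y by (auto simp: successions_def)
    qed
    moreover have "q \<le> r" using ys(2) unfolding aq \<open>x = a\<close>[symmetric] by (rule rmax)
    moreover have "r \<le> q" using sublist_length_le[OF ys(3)] by (simp add: aq xs_def del: upt_Suc)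
    ultimately show ?thesis by (simp add: aq xs_def del: upt_Suc)
  qed
  then have "xs \<in> blocks \<tau>" using r by (auto simp: blocks_def xs_def consecutive_run_def simp del: upt_Suc)
  then show "x \<in> hd ` blocks \<tau>" using ne by force
qed

text \<open>Runs with the same head are comparable as prefixes, and maximality turns comparability
  into equality.\<close>

lemma inj_on_hd_blocks: "inj_on hd (blocks \<tau>)"
proof (rule inj_onI)
  fix xs ys assume A: "xs \<in> blocks \<tau>" "ys \<in> blocks \<tau>" "hd xs = hd ys"
  then have run: "consecutive_run xs" "consecutive_run ys" by (auto simp: blocks_def)
  have X: "xs = [hd xs..<Suc (last xs)]" "ys = [hd xs..<Suc (last ys)]" "hd xs \<le> last xs" "hd xs \<le> last ys"
    using hd_run[OF run(1)] hd_run[OF run(2)] A(3) by auto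
  have pre: "prefix [a..<b] [a..<c]" if "b \<le> c" "a \<le> b" for a b c :: nat
    using that upt_add_eq_append[of a b "c - b"] by (auto simp: prefix_def)
  have "sublist xs ys \<or> sublist ys xs"
    using X pre[of "Suc (last xs)" "Suc (last ys)" "hd xs"] pre[of "Suc (last ys)" "Suc (last xs)" "hd xs"]
    by (metis le_SucI linear not_less_eq_eq prefix_imp_sublist)
  then show "xs = ys" using A by (auto simp: blocks_def)
qed

lemma card_blocks:
  assumes "distinct \<tau>"
  shows "card (blocks \<tau>) = length \<tau> - card (successions \<tau>)"
proof -
  have "card (blocks \<tau>) = card (hd ` blocks \<tau>)" by (rule card_image[OF inj_on_hd_blocks, symmetric])
  also have "\<dots> = card (set \<tau>) - card (Suc ` successions \<tau>)"
    unfolding hd_blocks[OF assms]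
    by (intro card_Diff_subset finite_imageI finite_successions)
      (auto simp: successions_def dest: sublist_pair_mem)
  finally show ?thesis using assms by (simp add: distinct_card card_image)
qed

section \<open>Counting permutations by their number of successions\<close>

text \<open>The sequence 1, 1, 1, 3, 11, 53, ... . For \<open>n \<ge> 1\<close> its meaning comes
  from the case \<open>j = 0\<close> of \<open>num_succession_perms_eq\<close>.\<close>

fun succession_free_perms :: "nat \<Rightarrow> nat" where
  "succession_free_perms 0 = 1"
| "succession_free_perms (Suc 0) = 1"
| "succession_free_perms (Suc (Suc n)) =
     Suc n * succession_free_perms (Suc n) + n * succession_free_perms n"

text \<open>The place is named by the left neighbour of the new entry because successions depend on
  neighbouring values. The value 0, which no permutation of \<open>{1..n}\<close> contains, stands
  for the front.\<close>

definition insert_after :: "nat \<Rightarrow> nat \<Rightarrow> nat list \<Rightarrow> nat list" where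
  "insert_after v x \<tau> =
     (if v \<in> set \<tau> then takeWhile (\<lambda>y. y \<noteq> v) \<tau> @ v # x # tl (dropWhile (\<lambda>y. y \<noteq> v) \<tau>) else x # \<tau>)"

lemma insert_after_split: "v \<notin> set A \<Longrightarrow> insert_after v x (A @ v # B) = A @ v # x # B"
  by (auto simp: insert_after_def takeWhile_append2 dropWhile_append)

lemma insert_after_notin: "v \<notin> set \<tau> \<Longrightarrow> insert_after v x \<tau> = x # \<tau>"
  by (simp add: insert_after_def)

lemma perm_split_cases:
  fixes \<tau> :: "nat list"
  assumes "\<tau> \<in> permutations_of_set {1..n}" "v \<in> {0..n}"
  obtains "v = 0" "v \<notin> set \<tau>" | A B where "\<tau> = A @ v # B" "v \<notin> set A" "v \<notin> set B"
proof (cases "v = 0")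
  case True
  moreover have "0 \<notin> set \<tau>" using permutations_of_setD(1)[OF assms(1)] by auto
  ultimately show ?thesis using that(1) by blast
next
  case False
  then have "v \<in> set \<tau>" "distinct \<tau>" using assms by (auto dest: permutations_of_setD)
  moreover from this obtain A B where "\<tau> = A @ v # B" using split_list[of v \<tau>] by blast
  ultimately show ?thesis using that(2) by auto
qed

lemma bij_betw_insert_after:
  "bij_betw (\<lambda>(\<tau>, v). insert_after v (Suc n) \<tau>)
     (permutations_of_set {1..n} \<times> {0..n}) (permutations_of_set {1..Suc n})"
\<comment> \<open>The inverse removes \<open>Suc n\<close> and reads off its left neighbour; the
  prepended 0 is the answer when \<open>Suc n\<close> stands at the front.\<close>
proof (rule bij_betw_byWitness[where f' =
      "\<lambda>\<tau>. (remove1 (Suc n) \<tau>, last (0 # takeWhile (\<lambda>y. y \<noteq> Suc n) \<tau>))"])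
  let ?ins = "\<lambda>(\<tau>, v). insert_after v (Suc n) \<tau>"
  let ?rem = "\<lambda>\<tau>. (remove1 (Suc n) \<tau>, last (0 # takeWhile (\<lambda>y. y \<noteq> Suc n) \<tau>))"
  have new: "Suc n \<notin> set \<tau>" if "\<tau> \<in> permutations_of_set {1..n}" for \<tau>
    using permutations_of_setD[OF that] by auto
  show "\<forall>a\<in>permutations_of_set {1..n} \<times> {0..n}. ?rem (?ins a) = a"
  proof (rule ballI, elim SigmaE, hypsubst)
    fix \<tau> v assume T: "\<tau> \<in> permutations_of_set {1..n}" and v: "v \<in> {0..n}"
    from T v show "?rem (?ins (\<tau>, v)) = (\<tau>, v)"
    proof (cases rule: perm_split_cases)
      case 1
      then show ?thesis by (simp add: insert_after_notin)
    next
      case (2 A B)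
      then have "Suc n \<notin> set A" "Suc n \<notin> set B" "Suc n \<noteq> v" using new[OF T] by auto
      moreover from this have "takeWhile (\<lambda>y. y \<noteq> Suc n) (A @ v # Suc n # B) = A @ [v]"
        by (subst takeWhile_append2) auto
      ultimately show ?thesis using 2 by (simp add: insert_after_split remove1_append)
    qed
  qed
  show "\<forall>b\<in>permutations_of_set {1..Suc n}. ?ins (?rem b) = b"
  proof
    fix \<tau> assume T: "\<tau> \<in> permutations_of_set {1..Suc n}"
    then have d: "distinct \<tau>" "set \<tau> = {1..Suc n}" by (auto dest: permutations_of_setD)
    then obtain C D where CD: "\<tau> = C @ Suc n # D" using split_list[of "Suc n" \<tau>] by auto
    then have nC: "Suc n \<notin> set C" using d by auto
    then have "takeWhile (\<lambda>y. y \<noteq> Suc n) (C @ Suc n # D) = C" by (subst takeWhile_append2) auto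
    then have rem: "?rem \<tau> = (C @ D, last (0 # C))" using CD nC by (simp add: remove1_append)
    show "?ins (?rem \<tau>) = \<tau>"
    proof (cases C rule: rev_cases)
      case Nil
      then have "0 \<notin> set D" using CD d(2) by auto
      then show ?thesis using Nil rem CD insert_after_notin[of 0 D] by simp
    next
      case (snoc A v)
      then show ?thesis using rem CD d(1) insert_after_split[of v A "Suc n" D] by simp
    qed
  qed
  show "?ins ` (permutations_of_set {1..n} \<times> {0..n}) \<subseteq> permutations_of_set {1..Suc n}"
  proof clarify
    fix \<tau> v assume T: "\<tau> \<in> permutations_of_set {1..n}" and v: "v \<in> {0..n}"
    note d = permutations_of_setD[OF T]
    from T v show "insert_after v (Suc n) \<tau> \<in> permutations_of_set {1..Suc n}"
    proof (cases rule: perm_split_cases)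
      case 1
      then show ?thesis using d by (auto simp: insert_after_notin intro!: permutations_of_setI)
    next
      case (2 A B)
      have "set (insert_after v (Suc n) \<tau>) = insert (Suc n) (set \<tau>)"
        using 2 by (auto simp: insert_after_split)
      moreover have "distinct (insert_after v (Suc n) \<tau>)"
        using 2 new[OF T] d by (auto simp: insert_after_split)
      ultimately show ?thesis using d by (auto intro!: permutations_of_setI)
    qed
  qed
  show "?rem ` permutations_of_set {1..Suc n} \<subseteq> permutations_of_set {1..n} \<times> {0..n}"
  proof
    fix p assume "p \<in> ?rem ` permutations_of_set {1..Suc n}"
    then obtain \<tau> where T: "\<tau> \<in> permutations_of_set {1..Suc n}" and p: "p = ?rem \<tau>" by auto
    note d = permutations_of_setD[OF T]
    obtain C D where CD: "\<tau> = C @ Suc n # D" using split_list[of "Suc n" \<tau>] d by auto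
    then have nC: "Suc n \<notin> set C" using d by auto
    then have "takeWhile (\<lambda>y. y \<noteq> Suc n) (C @ Suc n # D) = C" by (subst takeWhile_append2) auto
    then have rem: "?rem \<tau> = (C @ D, last (0 # C))" using CD nC by (simp add: remove1_append)
    have s: "set (C @ D) = {1..n}" "distinct (C @ D)"
    proof -
      have "set (C @ D) = set \<tau> - {Suc n}" using CD d(2) by auto
      then show "set (C @ D) = {1..n}" using d(1) by auto
    qed (use CD d(2) in auto)
    have "last (0 # C) \<in> set (0 # C)" by (rule last_in_set) simp
    also have "set (0 # C) \<subseteq> {0..n}" using s by auto
    finally show "p \<in> permutations_of_set {1..n} \<times> {0..n}"
      using s unfolding p rem by (auto intro: permutations_of_setI)
  qed
qed

text \<open>The insertion separates \<open>v\<close> from its right neighbour, so only a succession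
  at \<open>v\<close> can be lost. The new entry completes one only when \<open>v = n\<close>, and
  its own successor value \<open>n + 2\<close> is absent.\<close>

lemma successions_insert_after:
  assumes T: "\<tau> \<in> permutations_of_set {1..n}" and v: "v \<in> {0..n}" and n: "n \<ge> 1"
  shows "successions (insert_after v (Suc n) \<tau>) =
    (successions \<tau> - {v}) \<union> (if v = n then {n} else {})"
proof -
  note d = permutations_of_setD[OF T]
  from T v show ?thesis
  proof (cases rule: perm_split_cases)
    case 1
    have "\<tau> \<noteq> []" using d n by auto
    then have "hd \<tau> \<noteq> Suc (Suc n)" using d hd_in_set[of \<tau>] by auto
    then show ?thesis using 1 n
      by (auto simp: insert_after_notin successions_def sublist_pair_Cons dest: sublist_pair_mem)
  next
    case (2 A B)
    have hdB: "hd B \<noteq> Suc (Suc n)" if "B \<noteq> []"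
      using 2 d hd_in_set[OF that] by auto
    have nv: "sublist [y, Suc y] A \<Longrightarrow> y \<noteq> v" "sublist [y, Suc y] B \<Longrightarrow> y \<noteq> v"
      "A \<noteq> [] \<Longrightarrow> last A = y \<Longrightarrow> y \<noteq> v" for y
      using 2 by (auto dest: sublist_pair_mem last_in_set)
    have "sublist [y, Suc y] (A @ v # Suc n # B) \<longleftrightarrow>
        sublist [y, Suc y] (A @ v # B) \<and> y \<noteq> v \<or> v = n \<and> y = n" for y
      unfolding sublist_pair_append sublist_pair_Cons using nv[of y] hdB by auto
    then show ?thesis using 2 by (auto simp: insert_after_split successions_def)
  qed
qed

lemma successions_perm_subset:
  assumes "\<tau> \<in> permutations_of_set {1..n}"
  shows "successions \<tau> \<subseteq> {1..<n}"
  using permutations_of_setD[OF assms] by (auto simp: successions_def dest!: sublist_pair_mem)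

text \<open>Of the \<open>n + 1\<close> places for the new entry, the one after \<open>n\<close>
  adds a succession, each of the \<open>s\<close> places inside a succession removes one, and the
  other \<open>n - s\<close> keep the number.\<close>

lemma sum_successions_Suc:
  fixes f :: "nat \<Rightarrow> nat"
  assumes n: "n \<ge> 1"
  shows "(\<Sum>\<tau>\<in>permutations_of_set {1..Suc n}. f (card (successions \<tau>))) =
    (\<Sum>\<tau>\<in>permutations_of_set {1..n}. let s = card (successions \<tau>) in f (Suc s) + s * f (s - 1) + (n - s) * f s)"
proof -
  have "(\<Sum>\<tau>\<in>permutations_of_set {1..Suc n}. f (card (successions \<tau>))) =
    (\<Sum>\<tau>\<in>permutations_of_set {1..n}. \<Sum>v\<in>{0..n}. f (card (successions (insert_after v (Suc n) \<tau>))))"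
    by (subst sum.reindex_bij_betw[OF bij_betw_insert_after, symmetric])
      (simp add: sum.cartesian_product case_prod_unfold)
  also have "\<dots> = (\<Sum>\<tau>\<in>permutations_of_set {1..n}.
      let s = card (successions \<tau>) in f (Suc s) + s * f (s - 1) + (n - s) * f s)"
  proof (rule sum.cong[OF refl])
    fix \<tau> assume T: "\<tau> \<in> permutations_of_set {1..n}"
    let ?J = "successions \<tau>" and ?g = "\<lambda>v. f (card (successions (insert_after v (Suc n) \<tau>)))"
    have J: "?J \<subseteq> {1..<n}" by (rule successions_perm_subset[OF T])
    have split: "{0..n} = insert n (?J \<union> ({0..<n} - ?J))" using J by auto
    have "sum ?g {0..n} = ?g n + (sum ?g ?J + sum ?g ({0..<n} - ?J))"
      unfolding split using J by (subst sum.insert; (subst sum.union_disjoint)?) auto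
    moreover have "?g n = f (Suc (card ?J))"
    proof -
      have "n \<notin> ?J" using J by auto
      then show ?thesis using successions_insert_after[OF T, of n] n by simp
    qed
    moreover have "sum ?g ?J = card ?J * f (card ?J - 1)"
    proof -
      have "?g v = f (card ?J - 1)" if "v \<in> ?J" for v
      proof -
        have "v \<in> {0..n}" "v \<noteq> n" using J that by auto
        then show ?thesis using successions_insert_after[OF T _ n, of v] that by simp
      qed
      then show ?thesis by simp
    qed
    moreover have "sum ?g ({0..<n} - ?J) = (n - card ?J) * f (card ?J)"
    proof -
      have "?g v = f (card ?J)" if "v \<in> {0..<n} - ?J" for v
        using successions_insert_after[OF T _ n, of v] that by simp
      moreover have "card ({0..<n} - ?J) = n - card ?J"
        using J by (subst card_Diff_subset) auto
      ultimately show ?thesis by simp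
    qed
    ultimately show "sum ?g {0..n} = (let s = card ?J in f (Suc s) + s * f (s - 1) + (n - s) * f s)"
      by (simp add: Let_def)
  qed
  finally show ?thesis .
qed

definition num_succession_perms :: "nat \<Rightarrow> nat \<Rightarrow> nat" where
  "num_succession_perms n j = card {\<tau> \<in> permutations_of_set {1..n}. card (successions \<tau>) = j}"

lemma num_succession_perms_Suc:
  assumes "n \<ge> 1"
  shows "num_succession_perms (Suc n) j =
    (if j = 0 then 0 else num_succession_perms n (j - 1)) +
    Suc j * num_succession_perms n (Suc j) + (n - j) * num_succession_perms n j"
proof -
  have cnt: "num_succession_perms n j =
      (\<Sum>\<tau>\<in>permutations_of_set {1..n}. of_bool (card (successions \<tau>) = j))" for n j
    unfolding num_succession_perms_def by (simp add: of_bool_def sum.If_cases Int_def)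
  have "num_succession_perms (Suc n) j = (\<Sum>\<tau>\<in>permutations_of_set {1..n}.
      (let s = card (successions \<tau>) in of_bool (Suc s = j) + s * of_bool (s - 1 = j) + (n - s) * of_bool (s = j)))"
    unfolding cnt using sum_successions_Suc[OF assms, of "\<lambda>s. of_bool (s = j)"] by simp
  also have "\<dots> = (\<Sum>\<tau>\<in>permutations_of_set {1..n}.
      (if j = 0 then 0 else of_bool (card (successions \<tau>) = j - 1)) +
      Suc j * of_bool (card (successions \<tau>) = Suc j) + (n - j) * of_bool (card (successions \<tau>) = j))"
  proof (rule sum.cong[OF refl])
    show "(let s = card (successions \<tau>) in of_bool (Suc s = j) + s * of_bool (s - 1 = j) + (n - s) * of_bool (s = j)) =
      (if j = 0 then 0 else of_bool (card (successions \<tau>) = j - 1)) +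
      Suc j * of_bool (card (successions \<tau>) = Suc j) + (n - j) * of_bool (card (successions \<tau>) = j)" for \<tau>
      by (cases "card (successions \<tau>)"; cases j) (auto simp: Let_def)
  qed
  finally show ?thesis
    unfolding cnt by (simp add: sum.distrib sum_distrib_left)
qed

text \<open>Heuristically, choose which \<open>j\<close> of the \<open>m\<close> possible
  successions occur and contract them to a succession-free permutation. The proof checks the product
  against the insertion recursion.\<close>

lemma num_succession_perms_eq:
  "num_succession_perms (Suc m) j = (m choose j) * succession_free_perms (Suc m - j)"
proof (induction m arbitrary: j)
  case 0
  have "successions [Suc 0] = {}" by (auto simp: successions_def dest: sublist_length_le)
  then have "{\<tau>. \<tau> = [Suc 0] \<and> card (successions \<tau>) = j} = (if j = 0 then {[Suc 0]} else {})"
    by auto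
  then show ?case by (simp add: num_succession_perms_def)
next
  case (Suc m)
  let ?F = succession_free_perms
  \<comment> \<open>This makes two of the three terms multiples of \<open>m choose j\<close>, to
    which the recursion of \<open>succession_free_perms\<close> applies; Pascal's rule absorbs the
    term from \<open>j - 1\<close>.\<close>
  have *: "Suc j * (m choose Suc j) = (m - j) * (m choose j)" for j
    by (metis Suc_times_binomial_add binomial_absorb_comp binomial_absorption mult.commute)
  have "Suc j * ((m choose Suc j) * ?F (m - j)) + (Suc m - j) * ((m choose j) * ?F (Suc m - j))
      = (m choose j) * ?F (Suc (Suc m) - j)"
  proof (cases "j \<le> m")
    case True
    then obtain d where d: "m = j + d" using le_Suc_ex by blast
    have "Suc j * (m choose Suc j) * ?F (m - j) = (m - j) * (m choose j) * ?F (m - j)"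
      by (simp only: *)
    then show ?thesis using d by (simp add: Suc_diff_le algebra_simps)
  qed (simp add: binomial_eq_0)
  then show ?case
    using num_succession_perms_Suc[of "Suc m" j] unfolding Suc.IH
    by (cases j) (simp_all add: algebra_simps)
qed

text \<open>The law of the number of successions for \<open>{1..m + 1}\<close>, not \<open>{1..m}\<close>.\<close>

definition succession_prob :: "nat \<Rightarrow> nat \<Rightarrow> real" where
  "succession_prob m j = real ((m choose j) * succession_free_perms (Suc m - j)) / fact (Suc m)"

lemma succession_prob_nonneg [simp]: "succession_prob m j \<ge> 0"
  by (simp add: succession_prob_def)

lemma sum_perms_successions:
  fixes g :: "nat \<Rightarrow> 'a::semiring_1"
  shows "(\<Sum>\<tau>\<in>permutations_of_set {1..Suc m}. g (card (successions \<tau>))) =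
    (\<Sum>j\<le>m. of_nat ((m choose j) * succession_free_perms (Suc m - j)) * g j)"
proof -
  let ?P = "permutations_of_set {1..Suc m}"
  have "card (successions \<tau>) \<le> m" if "\<tau> \<in> ?P" for \<tau>
    using card_mono[OF _ successions_perm_subset[OF that]] by simp
  then have "(\<Sum>\<tau>\<in>?P. g (card (successions \<tau>))) =
      (\<Sum>j\<le>m. \<Sum>\<tau>\<in>{\<tau>. \<tau> \<in> ?P \<and> card (successions \<tau>) = j}. g (card (successions \<tau>)))"
    by (intro sum.group[symmetric]) auto
  also have "\<dots> = (\<Sum>j\<le>m. of_nat (num_succession_perms (Suc m) j) * g j)"
    by (intro sum.cong refl) (simp add: num_succession_perms_def)
  finally show ?thesis unfolding num_succession_perms_eq .
qed

lemma sum_succession_prob: "(\<Sum>j\<le>m. succession_prob m j) = 1"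
proof -
  have "real (fact (Suc m)) = (\<Sum>j\<le>m. real ((m choose j) * succession_free_perms (Suc m - j)))"
    using sum_perms_successions[of "\<lambda>_. 1 :: real" m] by (simp del: fact_Suc)
  then have "(\<Sum>j\<le>m. real ((m choose j) * succession_free_perms (Suc m - j))) = fact (Suc m)"
    by (simp only: of_nat_fact)
  then show ?thesis
    unfolding succession_prob_def sum_divide_distrib[symmetric] by (simp del: fact_Suc)
qed

section \<open>Measurability and the first-step recursion\<close>

lemma sets_round_space [measurable_cong]:
  "sets round_space = sets (\<Pi>\<^sub>M k\<in>UNIV. count_space (UNIV :: nat list set))"
  unfolding round_space_def by (rule sets_PiM_cong) auto

lemma prob_space_round_space: "prob_space round_space"
  unfolding round_space_def by (intro prob_space_PiM prob_space_measure_pmf)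

lemma prob_space_process_space: "prob_space process_space"
  unfolding process_space_def by (rule prob_space.prob_space_stream_space[OF prob_space_round_space])

lemma measurable_round_component [measurable]:
  "(\<lambda>\<omega>. \<omega> k) \<in> measurable round_space (count_space UNIV)"
  by (subst measurable_cong_sets[OF sets_round_space refl]) simp

lemma measurable_num_left [measurable]:
  "(\<lambda>\<omega>. num_left n \<omega> t) \<in> measurable process_space (count_space UNIV)"
proof (induction t)
  case (Suc t)
  have "(\<lambda>\<omega>. (\<omega> !! t) k) \<in> measurable process_space (count_space UNIV)" for k
    unfolding process_space_def by measurable
  \<comment> \<open>The component that is read depends on the random current size; the countable
    range of sizes reduces the claim to fixed components.\<close>
  then have "(\<lambda>\<omega>. (\<omega> !! t) (num_left n \<omega> t)) \<in> measurable process_space (count_space UNIV)"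
    by (rule measurable_compose_countable[OF _ Suc])
  then show ?case by simp
qed simp

text \<open>Replaces the infimum by conditions on single times. As an \<open>enat\<close> is
  determined by the finite numbers below it, this yields both the measurability of
  \<open>num_perms\<close> and its one-step equation.\<close>

lemma enat_less_num_perms: "enat t < num_perms n \<omega> \<longleftrightarrow> (\<forall>s\<le>t. num_left n \<omega> s \<noteq> 1)"
proof -
  have "enat t < num_perms n \<omega> \<longleftrightarrow> enat (Suc t) \<le> num_perms n \<omega>"
    by (simp add: Suc_ile_eq)
  then show ?thesis
    unfolding num_perms_def le_INF_iff by (auto simp: Suc_le_eq not_le)
qed

lemma enat_eqI: "(\<And>t. enat t < a \<longleftrightarrow> enat t < b) \<Longrightarrow> a = b"
  by (metis linorder_neqE enat_ord_simps(4) not_enat_eq order_less_irrefl)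

lemma measurable_num_perms [measurable]:
  "num_perms n \<in> measurable process_space (count_space UNIV)"
proof -
  have lt: "Measurable.pred process_space (\<lambda>\<omega>. enat t < num_perms n \<omega>)" for t
    unfolding enat_less_num_perms by measurable
  have "num_perms n -` {a} \<inter> space process_space \<in> sets process_space" for a
  proof -
    have "num_perms n -` {a} \<inter> space process_space =
      {\<omega> \<in> space process_space. \<forall>t. enat t < num_perms n \<omega> \<longleftrightarrow> enat t < a}"
      by (auto intro: enat_eqI)
    also have "\<dots> \<in> sets process_space" using lt by measurable
    finally show ?thesis .
  qed
  then show ?thesis by (subst measurable_count_space_eq2_countable) auto
qed

lemma num_left_Stream: "num_left n (x ## \<omega>) (Suc t) = num_left (card (blocks (x n))) \<omega> t"
  by (induction t) auto

lemma num_perms_1 [simp]: "num_perms (Suc 0) \<omega> = 0"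
proof -
  have "\<not> enat 0 < num_perms 1 \<omega>" unfolding enat_less_num_perms by simp
  then show ?thesis by (simp add: zero_enat_def[symmetric])
qed

lemma num_perms_Stream:
  assumes "n \<noteq> 1"
  shows "num_perms n (x ## \<omega>) = eSuc (num_perms (card (blocks (x n))) \<omega>)"
proof (rule enat_eqI)
  fix t
  show "enat t < num_perms n (x ## \<omega>) \<longleftrightarrow> enat t < eSuc (num_perms (card (blocks (x n))) \<omega>)"
  proof (cases t)
    case 0
    have "enat 0 < num_perms n (x ## \<omega>)" using assms unfolding enat_less_num_perms by simp
    then show ?thesis using 0 by (simp add: zero_enat_def[symmetric])
  next
    case (Suc t')
    \<comment> \<open>Time 0 imposes no condition because \<open>n \<noteq> 1\<close>, so the
      remaining times shift by one.\<close>
    have "(\<forall>s\<le>Suc t'. num_left n (x ## \<omega>) s \<noteq> 1) \<longleftrightarrow>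
        (\<forall>s\<le>t'. num_left n (x ## \<omega>) (Suc s) \<noteq> 1)"
      using assms by (metis num_left.simps(1) Suc_le_mono not0_implies_Suc)
    moreover have "enat (Suc t') < eSuc c \<longleftrightarrow> enat t' < c" for c
      using eSuc_mono[of "enat t'" c] by (simp only: eSuc_enat)
    ultimately show ?thesis
      unfolding Suc num_left_Stream enat_less_num_perms[symmetric] by (simp only:)
  qed
qed

lemma nn_integral_round_space:
  fixes f :: "nat \<Rightarrow> ennreal"
  shows "(\<integral>\<^sup>+ x. f (card (blocks (x (Suc m)))) \<partial>round_space) =
    (\<Sum>j\<le>m. ennreal (succession_prob m j) * f (Suc m - j))"
proof -
  let ?P = "permutations_of_set {1..Suc m}"
  have "(\<integral>\<^sup>+ x. f (card (blocks (x (Suc m)))) \<partial>round_space) =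
      (\<integral>\<^sup>+ \<tau>. f (card (blocks \<tau>)) \<partial>measure_pmf (pmf_of_set ?P))"
    by (subst distr_PiM_component[where I = UNIV and i = "Suc m" and
          M = "\<lambda>k. measure_pmf (pmf_of_set (permutations_of_set {1..k}))", symmetric])
      (auto simp: nn_integral_distr round_space_def intro: prob_space_measure_pmf)
  also have "\<dots> = (\<Sum>\<tau>\<in>?P. f (card (blocks \<tau>))) / card ?P"
    by (rule nn_integral_pmf_of_set) auto
  also have "(\<Sum>\<tau>\<in>?P. f (card (blocks \<tau>))) = (\<Sum>\<tau>\<in>?P. f (Suc m - card (successions \<tau>)))"
  proof (rule sum.cong[OF refl])
    fix \<tau> assume "\<tau> \<in> ?P"
    then have "distinct \<tau>" "length \<tau> = Suc m"
      using length_finite_permutations_of_set[of \<tau> "{1..Suc m}"] by (auto dest: permutations_of_setD)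
    then show "f (card (blocks \<tau>)) = f (Suc m - card (successions \<tau>))" by (simp add: card_blocks)
  qed
  also have "\<dots> = (\<Sum>j\<le>m. of_nat ((m choose j) * succession_free_perms (Suc m - j)) * f (Suc m - j))"
    by (rule sum_perms_successions[of "\<lambda>j. f (Suc m - j)"])
  also have "\<dots> / card ?P = (\<Sum>j\<le>m. of_nat ((m choose j) * succession_free_perms (Suc m - j)) / of_nat (fact (Suc m)) * f (Suc m - j))"
    by (simp add: divide_ennreal_def sum_distrib_left mult_ac del: fact_Suc)
  also have "\<dots> = (\<Sum>j\<le>m. ennreal (succession_prob m j) * f (Suc m - j))"
    by (intro sum.cong refl arg_cong2[where f = times])
      (simp add: succession_prob_def divide_ennreal[symmetric] ennreal_of_nat_eq_real_of_nat del: fact_Suc of_nat_mult)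
  finally show ?thesis .
qed

text \<open>First-step analysis, kept general in \<open>F\<close> and \<open>G\<close> because it
  serves both \<open>num_perms\<close> and its truncations.\<close>

lemma nn_integral_process_step:
  assumes F: "F \<in> borel_measurable process_space"
    and G: "\<And>k. G k \<in> borel_measurable process_space"
    and step: "\<And>x \<omega>. F (x ## \<omega>) = 1 + G (card (blocks (x (Suc m)))) \<omega>"
  shows "(\<integral>\<^sup>+ \<omega>. F \<omega> \<partial>process_space) =
    1 + (\<Sum>j\<le>m. ennreal (succession_prob m j) * (\<integral>\<^sup>+ \<omega>. G (Suc m - j) \<omega> \<partial>process_space))"
proof -
  interpret P: prob_space process_space by (rule prob_space_process_space)
  interpret R: prob_space round_space by (rule prob_space_round_space)
  let ?f = "\<lambda>k. \<integral>\<^sup>+ \<omega>. G k \<omega> \<partial>process_space"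
  have "(\<integral>\<^sup>+ \<omega>. F \<omega> \<partial>process_space) = (\<integral>\<^sup>+ x. \<integral>\<^sup>+ \<omega>. F (x ## \<omega>) \<partial>process_space \<partial>round_space)"
    using R.nn_integral_stream_space F unfolding process_space_def by blast
  also have "\<dots> = (\<integral>\<^sup>+ x. 1 + ?f (card (blocks (x (Suc m)))) \<partial>round_space)"
    unfolding step by (intro nn_integral_cong) (simp add: nn_integral_add G P.emeasure_space_1)
  also have "\<dots> = 1 + (\<integral>\<^sup>+ x. ?f (card (blocks (x (Suc m)))) \<partial>round_space)"
    by (subst nn_integral_add) (auto simp: R.emeasure_space_1 intro!: measurable_compose[OF measurable_round_component])
  finally show ?thesis unfolding nn_integral_round_space[of ?f] .
qed

text \<open>The summand \<open>j = 0\<close> contains \<open>mu (Suc m)\<close> itself, so infinity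
  also solves this equation; finiteness is proved separately in \<open>mu_le\<close>.\<close>

lemma mu_rec:
  assumes "m \<ge> 1"
  shows "mu (Suc m) = 1 + (\<Sum>j\<le>m. ennreal (succession_prob m j) * mu (Suc m - j))"
  unfolding mu_def
  by (rule nn_integral_process_step) (use assms in \<open>auto simp: num_perms_Stream\<close>)

section \<open>Moments of the number of successions and finiteness of the mean\<close>

text \<open>Rewriting \<open>(m choose j) * (j choose i)\<close> as
  \<open>(m choose i) * (m - i choose (j - i))\<close> leaves a count of all permutations of
  \<open>{1..m - i + 1}\<close>.\<close>

lemma choose_moment:
  assumes "i \<le> m"
  shows "(\<Sum>j\<le>m. succession_prob m j * real (j choose i)) =
    real (m choose i) * fact (Suc m - i) / fact (Suc m)"
proof -
  let ?F = succession_free_perms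
  have "(\<Sum>j\<le>m. (m choose j) * ?F (Suc m - j) * (j choose i)) =
      (\<Sum>j\<in>{i..m}. (m choose j) * ?F (Suc m - j) * (j choose i))"
    by (rule sum.mono_neutral_right) (auto simp: not_le binomial_eq_0)
  also have "\<dots> = (\<Sum>j\<in>{i..m}. (m choose i) * ((m - i choose (j - i)) * ?F (Suc m - j)))"
    by (intro sum.cong refl) (simp add: mult.assoc[symmetric] choose_mult[symmetric])
  also have "\<dots> = (m choose i) * (\<Sum>j\<in>{i..m}. (m - i choose (j - i)) * ?F (Suc m - j))"
    by (simp add: sum_distrib_left)
  also have "(\<Sum>j\<in>{i..m}. (m - i choose (j - i)) * ?F (Suc m - j)) =
      (\<Sum>j\<le>m - i. (m - i choose j) * ?F (Suc (m - i) - j))"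
    by (rule sum.reindex_bij_witness[of _ "\<lambda>j. j + i" "\<lambda>j. j - i"]) (use assms in auto)
  also have "\<dots> = fact (Suc (m - i))"
    using sum_perms_successions[of "\<lambda>_. 1 :: nat" "m - i"] by (simp del: fact_Suc)
  finally have "(\<Sum>j\<le>m. (m choose j) * ?F (Suc m - j) * (j choose i)) = (m choose i) * fact (Suc m - i)"
    using assms by (simp add: Suc_diff_le del: fact_Suc)
  then have "real (\<Sum>j\<le>m. (m choose j) * ?F (Suc m - j) * (j choose i)) =
      real (m choose i) * fact (Suc m - i)"
    by (simp only: of_nat_mult of_nat_fact)
  then show ?thesis
    unfolding succession_prob_def by (simp add: sum_divide_distrib[symmetric] del: fact_Suc)
qed

lemma succession_mean: "(\<Sum>j\<le>m. succession_prob m j * real j) = real m / real (Suc m)"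
proof (cases m)
  case (Suc k)
  have "fact (Suc m - 1) / fact (Suc m) = 1 / real (Suc m)"
    by (simp add: fact_Suc[of m] del: of_nat_Suc)
  then show ?thesis using choose_moment[of 1 m] Suc
    by (simp only: times_divide_eq_right[symmetric]) simp
qed simp

text \<open>A drift argument: for \<open>m \<ge> 1\<close> a round removes
  \<open>m / (m + 1) \<ge> 1 / 2\<close> integers on average, so the potential \<open>2 * m\<close>
  drops by at least 1. Truncation allows induction on \<open>t\<close> before finiteness is
  known.\<close>

lemma truncated_mean_le:
  "(\<integral>\<^sup>+ \<omega>. ennreal_of_enat (min (num_perms (Suc m) \<omega>) (enat t)) \<partial>process_space) \<le> ennreal (2 * real m)"
proof (induction t arbitrary: m)
  case 0
  then show ?case by (simp add: zero_enat_def[symmetric])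
next
  case (Suc t)
  show ?case
  proof (cases "m = 0")
    case False
    have "(\<integral>\<^sup>+ \<omega>. ennreal_of_enat (min (num_perms (Suc m) \<omega>) (enat (Suc t))) \<partial>process_space) =
      1 + (\<Sum>j\<le>m. ennreal (succession_prob m j) *
            (\<integral>\<^sup>+ \<omega>. ennreal_of_enat (min (num_perms (Suc m - j) \<omega>) (enat t)) \<partial>process_space))"
    proof (rule nn_integral_process_step)
      have "min (eSuc a) (enat (Suc t)) = eSuc (min a (enat t))" for a
        by (simp add: eSuc_enat[symmetric] min_def)
      then show "ennreal_of_enat (min (num_perms (Suc m) (x ## \<omega>)) (enat (Suc t))) =
          1 + ennreal_of_enat (min (num_perms (card (blocks (x (Suc m)))) \<omega>) (enat t))" for x \<omega>
        using False by (simp add: num_perms_Stream)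
    qed measurable
    also have "\<dots> \<le> 1 + (\<Sum>j\<le>m. ennreal (succession_prob m j) * ennreal (2 * real (m - j)))"
    proof (intro add_left_mono sum_mono mult_left_mono)
      show "(\<integral>\<^sup>+ \<omega>. ennreal_of_enat (min (num_perms (Suc m - j) \<omega>) (enat t)) \<partial>process_space)
          \<le> ennreal (2 * real (m - j))" if "j \<in> {..m}" for j
        using Suc.IH[of "m - j"] that by (simp add: Suc_diff_le del: of_nat_diff)
    qed simp
    also have "\<dots> = ennreal (1 + (\<Sum>j\<le>m. succession_prob m j * (2 * real (m - j))))"
      by (simp add: ennreal_mult[symmetric] sum_nonneg del: of_nat_diff)
    also have "(\<Sum>j\<le>m. succession_prob m j * (2 * real (m - j))) =
        2 * real m * (\<Sum>j\<le>m. succession_prob m j) - 2 * (\<Sum>j\<le>m. succession_prob m j * real j)"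
      unfolding sum_distrib_left sum_subtractf[symmetric]
      by (intro sum.cong refl) (simp add: of_nat_diff algebra_simps)
    also have "1 + \<dots> \<le> 2 * real m"
      using False unfolding sum_succession_prob succession_mean by (simp add: field_simps)
    finally show ?thesis by (simp add: ennreal_leI)
  qed simp
qed

lemma mu_le: "mu (Suc m) \<le> ennreal (2 * real m)"
proof -
  let ?f = "\<lambda>t \<omega>. ennreal_of_enat (min (num_perms (Suc m) \<omega>) (enat t))"
  have "(SUP t. ?f t \<omega>) = ennreal_of_enat (num_perms (Suc m) \<omega>)" for \<omega>
  proof (cases "num_perms (Suc m) \<omega>")
    case (enat k)
    then show ?thesis by (intro antisym SUP_least SUP_upper2[of k]) auto
  next
    case infinity
    then show ?thesis by (simp add: ennreal_SUP_of_nat_eq_top)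
  qed
  then have "mu (Suc m) = (\<integral>\<^sup>+ \<omega>. (SUP t. ?f t \<omega>) \<partial>process_space)"
    by (simp add: mu_def)
  also have "\<dots> = (SUP t. \<integral>\<^sup>+ \<omega>. ?f t \<omega> \<partial>process_space)"
    by (intro nn_integral_monotone_convergence_SUP)
      (auto simp: incseq_def le_fun_def intro: min.coboundedI2)
  also have "\<dots> \<le> ennreal (2 * real m)"
    by (intro SUP_least truncated_mean_le)
  finally show ?thesis .
qed

lemma mu_finite: "n \<ge> 1 \<Longrightarrow> mu n < \<infinity>"
  using mu_le[of "n - 1"] by (simp add: le_less_trans[OF _ ennreal_less_top])

lemma real_mu_rec:
  assumes "m \<ge> 1"
  shows "enn2real (mu (Suc m)) = 1 + (\<Sum>j\<le>m. succession_prob m j * enn2real (mu (Suc m - j)))"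
proof -
  have e: "mu (Suc m - j) = ennreal (enn2real (mu (Suc m - j)))" if "j \<le> m" for j
    using mu_finite[of "Suc m - j"] that by simp
  have "mu (Suc m) = 1 + (\<Sum>j\<le>m. ennreal (succession_prob m j) * ennreal (enn2real (mu (Suc m - j))))"
    unfolding mu_rec[OF assms] using e by (intro arg_cong2[where f = plus] sum.cong refl) auto
  also have "\<dots> = ennreal (1 + (\<Sum>j\<le>m. succession_prob m j * enn2real (mu (Suc m - j))))"
    by (simp add: ennreal_mult[symmetric] sum_nonneg)
  finally show ?thesis
    using sum_nonneg[of "{..m}" "\<lambda>j. succession_prob m j * enn2real (mu (Suc m - j))"]
    by (simp only: enn2real_ennreal) simp
qed

section \<open>Derangement ratios\<close>

text \<open>The proportion of derangements among the permutations of \<open>n + 1\<close> points: writing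
  \<open>D\<^sub>n\<close> for the number of derangements, \<open>n * succession_free_perms n = D\<^sub>n\<^sub>+\<^sub>1\<close>.\<close>

definition derangement_ratio :: "nat \<Rightarrow> real" where
  "derangement_ratio n = real (n * succession_free_perms n) / fact (Suc n)"

lemma derangement_ratio_0 [simp]: "derangement_ratio 0 = 0"
  and derangement_ratio_1 [simp]: "derangement_ratio (Suc 0) = 1 / 2"
  by (simp_all add: derangement_ratio_def)

lemma derangement_ratio_rec:
  "derangement_ratio (Suc (Suc n)) =
     (real (n + 2) * derangement_ratio (Suc n) + derangement_ratio n) / real (n + 3)"
proof -
  define q :: real where "q = fact (Suc n)"
  define x where "x = real n"
  have q: "q \<noteq> 0" and x: "x \<ge> 0" by (simp_all add: q_def x_def)
  have f: "fact (Suc (Suc n)) = (x + 2) * q" "fact (Suc (Suc (Suc n))) = (x + 3) * ((x + 2) * q)"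
    by (simp_all add: q_def x_def algebra_simps)
  have "(x + 2) * ((x + 1) * u + x * v) / ((x + 3) * ((x + 2) * q)) =
      ((x + 2) * ((x + 1) * u / ((x + 2) * q)) + x * v / q) / (x + 3)" for u v
    using q x by (simp add: divide_simps)
  moreover have "real (Suc (Suc n) * (Suc n * u + n * v)) = (x + 2) * ((x + 1) * real u + x * real v)"
    "real (Suc n * u) = (x + 1) * real u" "real (n * v) = x * real v" "real (n + 2) = x + 2" "real (n + 3) = x + 3"
    for u v by (simp_all add: x_def algebra_simps)
  ultimately show ?thesis
    unfolding derangement_ratio_def f q_def[symmetric] succession_free_perms.simps by metis
qed

text \<open>The cases \<open>m < 8\<close> of \<open>drift_lower_small\<close> need the ratios at
  \<open>m + 1 - j\<close>, hence up to 8.\<close>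

lemma derangement_ratio_eval:
  "derangement_ratio 1 = 1 / 2" "derangement_ratio 2 = 1 / 3" "derangement_ratio 3 = 3 / 8"
  "derangement_ratio 4 = 11 / 30" "derangement_ratio 5 = 53 / 144" "derangement_ratio 6 = 103 / 280"
  "derangement_ratio 7 = 2119 / 5760" "derangement_ratio 8 = 16687 / 45360"
  by (simp_all add: eval_nat_numeral derangement_ratio_rec)

text \<open>The recursion makes each ratio a convex combination of the two preceding ones.\<close>

lemma derangement_ratio_bounds:
  assumes "n \<ge> 4"
  shows "11 / 30 \<le> derangement_ratio n" "derangement_ratio n < 3 / 8"
proof -
  \<comment> \<open>The bounds are the ratios at 4 and at 3; they enclose the limit
    \<open>exp (- 1)\<close>. Two consecutive indices are carried because the recursion reaches back
    two steps.\<close>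
  have "11 / 30 \<le> derangement_ratio (k + 4) \<and> derangement_ratio (k + 4) < 3 / 8 \<and>
      11 / 30 \<le> derangement_ratio (k + 5) \<and> derangement_ratio (k + 5) < 3 / 8" for k
  proof (induction k)
    case (Suc k)
    let ?a = "derangement_ratio (k + 4)" and ?b = "derangement_ratio (k + 5)"
    have r: "derangement_ratio (Suc k + 5) * (real k + 7) = (real k + 6) * ?b + ?a"
      using derangement_ratio_rec[of "k + 4"] by (simp add: field_simps)
    have "(real k + 6) * (11 / 30) \<le> (real k + 6) * ?b" "(real k + 6) * ?b < (real k + 6) * (3 / 8)"
      using Suc.IH by (intro mult_left_mono mult_strict_left_mono; simp)+
    then have "(11 / 30) * (real k + 7) \<le> derangement_ratio (Suc k + 5) * (real k + 7)"
      "derangement_ratio (Suc k + 5) * (real k + 7) < (3 / 8) * (real k + 7)"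
      unfolding r using Suc.IH by (auto simp: algebra_simps)
    then have "11 / 30 \<le> derangement_ratio (Suc k + 5)" "derangement_ratio (Suc k + 5) < 3 / 8"
      using mult_right_le_imp_le[of "11 / 30" "real k + 7"]
        mult_right_less_imp_less[of _ "real k + 7" "3 / 8"] by auto
    then show ?case using Suc.IH by (simp add: algebra_simps)
  qed (simp add: derangement_ratio_eval)
  from this[of "n - 4"] assms show "11 / 30 \<le> derangement_ratio n" "derangement_ratio n < 3 / 8"
    by simp_all
qed

text \<open>Exhibits the Poisson shape: weight \<open>1 / fact j\<close>, a ratio near
  \<open>exp (- 1)\<close>, and a correction factor. Bounds on the ratios thus become bounds on
  these probabilities.\<close>

lemma succession_prob_ratio:
  assumes "j \<le> m"
  shows "succession_prob m j =
    real (m + 2 - j) / (real (m + 1) * fact j) * derangement_ratio (m + 1 - j)"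
proof -
  obtain k where m: "m = j + k" using assms le_Suc_ex by blast
  have c: "real (m choose j) = fact m / (fact j * fact k)"
    using binomial_fact[of j m, where ?'a = real] m by simp
  have "fact (Suc m) = real (m + 1) * fact m" "fact (Suc (Suc k)) = real (k + 2) * real (k + 1) * fact k"
    by (simp_all add: algebra_simps)
  moreover have "(fact m :: real) \<noteq> 0" "(fact k :: real) \<noteq> 0" "(fact j :: real) \<noteq> 0" by simp_all
  moreover have "Suc m - j = Suc k" "m + 1 - j = Suc k" "m + 2 - j = k + 2" using m by auto
  ultimately show ?thesis
    unfolding succession_prob_def derangement_ratio_def of_nat_mult c
    by (simp add: divide_simps del: fact_Suc)
qed

section \<open>Tail sums and binomial moments\<close>

text \<open>At \<open>Suc i\<close> this is the weight P(S > i) of the recursion.\<close>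

definition succession_tail :: "nat \<Rightarrow> nat \<Rightarrow> real" where
  "succession_tail m i = (\<Sum>j=i..m. succession_prob m j)"

lemma succession_tail_nonneg [simp]: "succession_tail m i \<ge> 0"
  by (simp add: succession_tail_def sum_nonneg)

lemma succession_tail_0: "succession_tail m 0 = 1"
  by (simp add: succession_tail_def atLeast0AtMost sum_succession_prob)

lemma succession_tail_Suc: "i \<le> m \<Longrightarrow> succession_tail m i = succession_prob m i + succession_tail m (Suc i)"
  by (simp add: succession_tail_def sum.atLeast_Suc_atMost)

text \<open>Interchange of summations: \<open>g i\<close> is counted once for every outcome
  \<open>j > i\<close>.\<close>

lemma sum_succession_tail:
  "(\<Sum>i<m. g i * succession_tail m (Suc i)) = (\<Sum>j\<le>m. succession_prob m j * (\<Sum>i<j. g i))"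
  unfolding succession_tail_def sum_distrib_left sum.nested_swap' by (simp add: mult.commute)

lemma sum_tail_mean: "(\<Sum>i<m. succession_tail m (Suc i)) = real m / real (Suc m)"
  using sum_succession_tail[of "\<lambda>_. 1" m] by (simp add: succession_mean)

text \<open>The factorials in \<open>choose_moment\<close> cancel. At \<open>i = Suc m\<close> both
  sides vanish, so the fourth moment is available already from \<open>m = 3\<close>.\<close>

lemma choose_moment_ratio:
  assumes "i \<le> Suc m"
  shows "(\<Sum>j\<le>m. succession_prob m j * real (j choose i)) = (real m + 1 - real i) / ((real m + 1) * fact i)"
proof (cases "i = Suc m")
  case False
  then obtain k where m: "m = i + k" using assms le_Suc_ex[of i m] by auto
  have c: "real (m choose i) = fact m / (fact i * fact k)"
    using binomial_fact[of i m, where ?'a = real] m by simp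
  have "fact (Suc m) = real (m + 1) * fact m" "fact (Suc k) = real (k + 1) * fact k"
    by (simp_all add: algebra_simps)
  moreover have "(fact m :: real) \<noteq> 0" "(fact k :: real) \<noteq> 0" "(fact i :: real) \<noteq> 0" by simp_all
  moreover have "Suc m - i = Suc k" using m by auto
  ultimately show ?thesis
    using choose_moment[of i m] m unfolding c
    by (simp add: divide_simps del: fact_Suc) (simp add: algebra_simps)
qed (auto intro!: sum.neutral simp: binomial_eq_0)

lemma real_choose_2: "real (n choose 2) = real n * (real n - 1) / 2"
  by (induction n) (simp_all add: numeral_2_eq_2 field_simps)

lemma real_choose_3: "real (n choose 3) = real n * (real n - 1) * (real n - 2) / 6"
proof (induction n)
  case (Suc n)
  have "Suc n choose 3 = (n choose 2) + (n choose 3)" by (simp add: eval_nat_numeral)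
  then show ?case using Suc by (simp add: real_choose_2 field_simps)
qed simp

lemma sum_id_choose: "(\<Sum>i<j. real i) = real (j choose 2)"
  by (induction j) (simp_all add: real_choose_2 field_simps)

text \<open>Reflects \<open>i ^ 3 = 6 * (i choose 3) + 6 * (i choose 2) + i\<close>; the binomial
  form is what \<open>choose_moment_ratio\<close> can average.\<close>

lemma sum_cubes_choose:
  "(\<Sum>i<j. real i ^ 3) = 6 * real (j choose 4) + 6 * real (j choose 3) + real (j choose 2)"
proof (induction j)
  case (Suc j)
  have "Suc j choose 4 = (j choose 3) + (j choose 4)" by (simp add: eval_nat_numeral)
  then show ?case using Suc by (simp add: real_choose_2 real_choose_3 field_simps power3_eq_cube)
qed (simp add: binomial_eq_0)

section \<open>Bounds on the right-hand side of the recursion\<close>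

text \<open>On \<open>{1..m-1}\<close> the convex function \<open>i \<mapsto> 1 / (m - i)\<close> lies below its chord, which is
  \<open>i / (m - 1)\<close>.\<close>

lemma drift_le:
  assumes "i < m" "m \<ge> 2"
  shows "1 / (real m - real i) - 1 / real m \<le> (real i + real i ^ 3 / (real m - 1)) / (real m)\<^sup>2"
proof (cases "i = 0")
  case False
  define x where "x = real i"
  define y where "y = real m"
  have xy: "1 \<le> x" "x \<le> y - 1" "y \<ge> 2" using assms False by (auto simp: x_def y_def)
  then have "0 \<le> (x - 1) * (y - 1 - x)" by simp
  then have chord: "1 / (y - x) \<le> x / (y - 1)"
    using xy by (simp add: field_simps)
  \<comment> \<open>This identity is exact, so the chord bound is spent only on the second-order
    part.\<close>
  have "1 / (y - x) - 1 / y = (x + x\<^sup>2 * (1 / (y - x))) / y\<^sup>2"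
    using xy by (simp add: field_simps power2_eq_square)
  also have "\<dots> \<le> (x + x\<^sup>2 * (x / (y - 1))) / y\<^sup>2"
    using chord by (intro divide_right_mono add_left_mono mult_left_mono) auto
  finally show ?thesis by (simp add: x_def y_def power3_eq_cube power2_eq_square)
qed simp

lemma succession_tail_1: "succession_tail m (Suc 0) = 1 - succession_prob m 0"
  using succession_tail_Suc[of 0 m] succession_tail_0[of m] by simp

text \<open>After \<open>drift_le\<close> the sum is a combination of binomial moments, hence
  explicit in \<open>m\<close>; it is compared with the bound on \<open>succession_tail m 1\<close>
  given by the derangement ratios.\<close>

lemma drift_upper:
  assumes "m \<ge> 2"
  shows "(\<Sum>i<m. (1 / (real m - real i) - 1 / real m) * succession_tail m (Suc i))
    < succession_tail m 1 / (real m)\<^sup>2"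
\<comment> \<open>The fourth moment and the bound on \<open>derangement_ratio (m + 1)\<close> apply
  from \<open>m = 3\<close> on.\<close>
proof (cases "m = 2")
  case True
  then show ?thesis
    by (simp add: succession_tail_def eval_nat_numeral succession_prob_def)
next
  case False
  then have m: "m \<ge> 3" using assms by simp
  have "(\<Sum>i<m. (1 / (real m - real i) - 1 / real m) * succession_tail m (Suc i))
      \<le> (\<Sum>i<m. (real i + real i ^ 3 / (real m - 1)) / (real m)\<^sup>2 * succession_tail m (Suc i))"
    using assms by (intro sum_mono mult_right_mono drift_le) auto
  also have "\<dots> = (\<Sum>j\<le>m. succession_prob m j *
      (real (j choose 2) + (6 * real (j choose 4) + 6 * real (j choose 3) + real (j choose 2)) / (real m - 1))) / (real m)\<^sup>2"
    unfolding sum_succession_tail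
    by (simp add: sum_divide_distrib[symmetric] sum.distrib sum_id_choose sum_cubes_choose)
  also have "(\<Sum>j\<le>m. succession_prob m j *
      (real (j choose 2) + (6 * real (j choose 4) + 6 * real (j choose 3) + real (j choose 2)) / (real m - 1))) =
      (\<Sum>j\<le>m. succession_prob m j * real (j choose 2)) +
      (6 * (\<Sum>j\<le>m. succession_prob m j * real (j choose 4)) + 6 * (\<Sum>j\<le>m. succession_prob m j * real (j choose 3))
        + (\<Sum>j\<le>m. succession_prob m j * real (j choose 2))) / (real m - 1)"
    unfolding sum_distrib_left sum.distrib[symmetric] sum_divide_distrib
    by (intro sum.cong refl) (simp add: field_simps)
  also have "\<dots> = (real m - 1) / (2 * (real m + 1)) + (7 * real m - 13) / (4 * (real m + 1) * (real m - 1))"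
    using m by (simp add: choose_moment_ratio fact_numeral divide_simps) (simp add: algebra_simps)
  also have "\<dots> < succession_tail m 1"
  proof -
    have "succession_prob m 0 = (real m + 2) / (real m + 1) * derangement_ratio (m + 1)"
      using succession_prob_ratio[of 0 m] by (simp add: add.commute)
    also have "\<dots> < (real m + 2) / (real m + 1) * (3 / 8)"
      using derangement_ratio_bounds(2)[of "m + 1"] m by (intro mult_strict_left_mono) auto
    finally have "1 - (real m + 2) / (real m + 1) * (3 / 8) < succession_tail m 1"
      by (simp add: succession_tail_1)
    moreover have "(real m - 1) / (2 * (real m + 1)) + (7 * real m - 13) / (4 * (real m + 1) * (real m - 1))
        \<le> 1 - (real m + 2) / (real m + 1) * (3 / 8)"
    proof -
      \<comment> \<open>The sides differ by a positive multiple of this product, which is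
        nonnegative because \<open>m\<close> is an integer. There is no slack at 4 and 5; strictness
        comes from the ratio being below 3/8.\<close>
      have "0 \<le> (real m - 4) * (real m - 5)"
        using m by (cases "m \<le> 4") (auto intro: mult_nonneg_nonneg mult_nonpos_nonpos)
      then have "0 \<le> (real m - 4) * (real m - 5) / (8 * (real m + 1) * (real m - 1))"
        using m by simp
      also have "\<dots> = 1 - (real m + 2) / (real m + 1) * (3 / 8) -
         ((real m - 1) / (2 * (real m + 1)) + (7 * real m - 13) / (4 * (real m + 1) * (real m - 1)))"
        using m by (simp add: divide_simps) (simp add: algebra_simps)
      finally show ?thesis by simp
    qed
    ultimately show ?thesis by simp
  qed
  finally show ?thesis using m by (simp add: divide_strict_right_mono)
qed

text \<open>In the recursion \<open>i\<close> belongs to \<open>e (m - i)\<close>: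
  \<open>i = 0\<close> is the unknown and \<open>i = m - 1\<close> gives \<open>e 1 = 0\<close>,
  which explains the range on the left. The estimate used from 8 on is too weak here, so the cases
  are evaluated.\<close>

lemma drift_lower_small:
  assumes "2 \<le> m" "m < 8"
  shows "(\<Sum>i\<in>{1..<m - 1}. 1 / (real m - real i)\<^sup>2 * succession_tail m (Suc i))
    < (\<Sum>i<m. (1 / (real m - real i) - 1 / real m) * succession_tail m (Suc i))"
proof -
  have "m = 2 \<or> m = 3 \<or> m = 4 \<or> m = 5 \<or> m = 6 \<or> m = 7" using assms by auto
  then show ?thesis
    by (elim disjE; hypsubst)
      (simp_all add: succession_tail_def succession_prob_ratio derangement_ratio_eval
        sum.atLeast_Suc_lessThan sum.atLeast_Suc_atMost lessThan_nat_numeral power2_eq_square fact_numeral)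
qed

text \<open>Only the summand \<open>i = 1\<close> of the difference is negative, and \<open>i = 2\<close> compensates it.\<close>

lemma drift_lower_large:
  assumes m: "m \<ge> 8"
  shows "(\<Sum>i\<in>{1..<m - 1}. 1 / (real m - real i)\<^sup>2 * succession_tail m (Suc i))
    < (\<Sum>i<m. (1 / (real m - real i) - 1 / real m) * succession_tail m (Suc i))"
proof -
  define y where "y = real m"
  have y: "y \<ge> 8" using m by (simp add: y_def)
  let ?Q = "\<lambda>i. succession_tail m (Suc i)"
  let ?c = "\<lambda>i. 1 / (y - real i) - 1 / y"
  let ?t = "\<lambda>i. (?c i - 1 / (y - real i)\<^sup>2) * ?Q i"
  have t_eq: "?t i = ((real i - 1) * y - (real i)\<^sup>2) / (y * (y - real i)\<^sup>2) * ?Q i" if "i < m" for i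
  proof -
    have "y - real i \<noteq> 0" "y \<noteq> 0" using that y by (auto simp: y_def)
    then have "?c i - 1 / (y - real i)\<^sup>2 = ((real i - 1) * y - (real i)\<^sup>2) / (y * (y - real i)\<^sup>2)"
      by (simp add: divide_simps power2_eq_square) (simp add: algebra_simps)
    then show ?thesis by simp
  qed
  have t_nonneg: "?t i \<ge> 0" if i: "i \<in> {1..<m - 1} - {1, 2}" for i
  proof -
    define x where "x = real i"
    have x: "x \<ge> 3" "x \<le> y - 2" using i by (auto simp: x_def y_def)
    \<comment> \<open>Used through
      \<open>(x - 1) * y - x^2 = (x - 2) * (y - 2 - x) + (y - 4)\<close>.\<close>
    then have "0 \<le> (x - 2) * (y - 2 - x)" by simp
    then have "0 \<le> (x - 1) * y - x\<^sup>2" using y by (simp add: algebra_simps power2_eq_square)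
    then have "0 \<le> ((real i - 1) * y - (real i)\<^sup>2) / (y * (y - real i)\<^sup>2) * ?Q i"
      using y by (intro mult_nonneg_nonneg divide_nonneg_nonneg) (auto simp: x_def)
    moreover have "i < m" using i by auto
    ultimately show ?thesis by (simp only: t_eq)
  qed
  \<comment> \<open>\<open>?Q 1\<close> is P(S \<ge> 2), the complement of two probabilities that
    the ratio bound 11/30 controls.\<close>
  have Q1: "?Q 1 \<le> (8 * y - 3) / (30 * (y + 1))"
  proof -
    have "succession_prob m 0 = (y + 2) / (y + 1) * derangement_ratio (m + 1)"
      using succession_prob_ratio[of 0 m] by (simp add: y_def add.commute)
    moreover have "(y + 2) / (y + 1) * (11 / 30) \<le> (y + 2) / (y + 1) * derangement_ratio (m + 1)"
      using derangement_ratio_bounds(1)[of "m + 1"] m y by (intro mult_left_mono) auto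
    moreover have "succession_prob m 1 = derangement_ratio m"
      using succession_prob_ratio[of 1 m] m by simp
    moreover have "11 / 30 \<le> derangement_ratio m" using derangement_ratio_bounds(1)[of m] m by simp
    moreover have "?Q 1 = 1 - succession_prob m 0 - succession_prob m 1"
      using succession_tail_Suc[of 1 m] succession_tail_1[of m] m by (simp add: numeral_2_eq_2)
    ultimately have "?Q 1 \<le> 1 - (y + 2) / (y + 1) * (11 / 30) - 11 / 30" by linarith
    also have "\<dots> = (8 * y - 3) / (30 * (y + 1))"
      using y by (simp add: divide_simps) (simp add: algebra_simps)
    finally show ?thesis .
  qed
  \<comment> \<open>\<open>?Q 2\<close> is P(S \<ge> 3), of which only P(S = 3) is kept.\<close>
  have Q2: "11 * (y - 1) / (180 * (y + 1)) \<le> ?Q 2"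
  proof -
    have "11 * (y - 1) / (180 * (y + 1)) = (y - 1) / ((y + 1) * 6) * (11 / 30)"
      using y by (simp add: divide_simps)
    also have "\<dots> \<le> (y - 1) / ((y + 1) * 6) * derangement_ratio (m - 2)"
      using derangement_ratio_bounds(1)[of "m - 2"] m y by (intro mult_left_mono) auto
    also have "\<dots> = succession_prob m 3"
    proof -
      have "m + 1 - 3 = m - 2" "real (m + 2 - 3) = y - 1" "real (m + 1) = y + 1" "fact 3 = (6 :: real)"
        using m by (auto simp: y_def fact_numeral)
      then show ?thesis using succession_prob_ratio[of 3 m] m by simp
    qed
    also have "\<dots> \<le> ?Q 2"
      using succession_tail_Suc[of 3 m] m by (simp add: eval_nat_numeral)
    finally show ?thesis .
  qed
  \<comment> \<open>This is \<open>?t 1 + ?t 2 > 0\<close> with the bounds on \<open>?Q 1\<close>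
    and \<open>?Q 2\<close> inserted and denominators cleared. It fails at \<open>y = 7\<close>,
    hence the threshold 8; in \<open>x = y - 8\<close> all coefficients are positive.\<close>
  have poly: "6 * (8 * y - 3) * (y - 2)\<^sup>2 < 11 * (y - 1) ^ 3 * (y - 4)"
  proof -
    define x where "x = y - 8"
    have x: "x \<ge> 0" "y = x + 8" using y by (auto simp: x_def)
    have "11 * (y - 1) ^ 3 * (y - 4) - 6 * (8 * y - 3) * (y - 2)\<^sup>2 =
        11 * x ^ 4 + 227 * x ^ 3 + 1599 * x\<^sup>2 + 4121 * x + 1916"
      unfolding x(2) by (simp add: power2_eq_square power3_eq_cube power4_eq_xxxx algebra_simps)
    also have "\<dots> > 0" using x(1) by (intro add_nonneg_pos add_nonneg_nonneg) auto
    finally show ?thesis by simp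
  qed
  have "?Q 1 * (y - 2)\<^sup>2 \<le> (8 * y - 3) / (30 * (y + 1)) * (y - 2)\<^sup>2"
    using Q1 by (rule mult_right_mono) simp
  also have "\<dots> = 6 * (8 * y - 3) * (y - 2)\<^sup>2 / (180 * (y + 1))" using y by (simp add: field_simps)
  also have "\<dots> < 11 * (y - 1) ^ 3 * (y - 4) / (180 * (y + 1))"
    using poly y by (intro divide_strict_right_mono) auto
  also have "\<dots> = 11 * (y - 1) / (180 * (y + 1)) * ((y - 1)\<^sup>2 * (y - 4))"
    by (simp add: power2_eq_square power3_eq_cube)
  also have "\<dots> \<le> ?Q 2 * ((y - 1)\<^sup>2 * (y - 4))"
    using Q2 y by (intro mult_right_mono) auto
  finally have main: "?Q 1 * (y - 2)\<^sup>2 < ?Q 2 * ((y - 1)\<^sup>2 * (y - 4))" .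
  have "0 < (?Q 2 * ((y - 1)\<^sup>2 * (y - 4)) - ?Q 1 * (y - 2)\<^sup>2) / (y * (y - 1)\<^sup>2 * (y - 2)\<^sup>2)"
    using main y by simp
  also have "\<dots> = - 1 / (y * (y - 1)\<^sup>2) * ?Q 1 + (y - 4) / (y * (y - 2)\<^sup>2) * ?Q 2"
    using y by (simp add: divide_simps)
  also have "\<dots> = ?t 1 + ?t 2" using t_eq[of 1] t_eq[of 2] m by simp
  also have "\<dots> = sum ?t {1, 2}" by simp
  also have "\<dots> \<le> sum ?t {1..<m - 1}"
    using m t_nonneg by (intro sum_mono2) auto
  also have "\<dots> = (\<Sum>i\<in>{1..<m - 1}. ?c i * ?Q i) - (\<Sum>i\<in>{1..<m - 1}. 1 / (y - real i)\<^sup>2 * ?Q i)"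
    by (simp add: left_diff_distrib sum_subtractf)
  also have "(\<Sum>i\<in>{1..<m - 1}. ?c i * ?Q i) \<le> (\<Sum>i<m. ?c i * ?Q i)"
    by (intro sum_mono2 mult_nonneg_nonneg) (auto simp: y_def intro!: divide_left_mono)
  finally show ?thesis by (simp add: y_def)
qed

lemma drift_lower:
  assumes "m \<ge> 2"
  shows "(\<Sum>i\<in>{1..<m - 1}. 1 / (real m - real i)\<^sup>2 * succession_tail m (Suc i))
    < (\<Sum>i<m. (1 / (real m - real i) - 1 / real m) * succession_tail m (Suc i))"
  using drift_lower_small[OF assms] drift_lower_large[of m] by linarith

lemma succession_tail_1_pos:
  assumes "m \<ge> 1"
  shows "0 < succession_tail m 1"
proof -
  have "0 < succession_prob m m" by (simp add: succession_prob_def)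
  also have "\<dots> \<le> succession_tail m 1"
    unfolding succession_tail_def using assms by (intro member_le_sum) auto
  finally show ?thesis .
qed

section \<open>Increments of the mean, the induction and the limit\<close>

text \<open>As the probabilities sum to 1, the recursion says that the drop of the mean over one
  round averages to 1; each drop telescopes into increments, which are then collected by
  \<open>i\<close>.\<close>

lemma mu_increments:
  assumes "m \<ge> 1"
  shows "(\<Sum>i<m. (enn2real (mu (Suc (m - i))) - enn2real (mu (m - i))) * succession_tail m (Suc i)) = 1"
proof -
  let ?M = "\<lambda>k. enn2real (mu k)"
  have tele: "(\<Sum>i<j. ?M (Suc (m - i)) - ?M (m - i)) = ?M (Suc m) - ?M (Suc m - j)" if "j \<le> m" for j
    using that
  proof (induction j)
    case (Suc j)
    then show ?case by (simp add: Suc_diff_le)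
  qed simp
  have "(\<Sum>i<m. (?M (Suc (m - i)) - ?M (m - i)) * succession_tail m (Suc i)) =
      (\<Sum>j\<le>m. succession_prob m j * (?M (Suc m) - ?M (Suc m - j)))"
    unfolding sum_succession_tail using tele by (intro sum.cong refl) simp
  also have "\<dots> = ?M (Suc m) * (\<Sum>j\<le>m. succession_prob m j) - (\<Sum>j\<le>m. succession_prob m j * ?M (Suc m - j))"
    by (simp add: right_diff_distrib sum_subtractf sum_distrib_left mult.commute)
  also have "\<dots> = 1" unfolding sum_succession_prob using real_mu_rec[OF assms] by simp
  finally show ?thesis .
qed

theorem theorem4p1:
  fixes \<epsilon> :: "nat \<Rightarrow> real"
  assumes "\<And>n. n \<ge> 1 \<Longrightarrow> enn2real (mu n) = real n + harm (n - 1) + \<epsilon> n"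
  shows "(\<forall>n\<ge>1. mu n < \<infinity>) \<and>
         convergent \<epsilon> \<and>
         (\<forall>n\<ge>2. 0 < \<epsilon> n - \<epsilon> (n + 1) \<and> \<epsilon> n - \<epsilon> (n + 1) < 1 / (real n)\<^sup>2)"
proof -
  define e where "e k = \<epsilon> k - \<epsilon> (k + 1)" for k
  have incr: "enn2real (mu (Suc k)) - enn2real (mu k) = 1 + 1 / real k - e k" if "k \<ge> 1" for k
  proof -
    have "harm k = harm (k - 1) + 1 / real k"
      using that by (cases k) (simp_all add: harm_Suc inverse_eq_divide)
    then show ?thesis using assms[of k] assms[of "Suc k"] that by (simp add: e_def)
  qed
  have balance: "(\<Sum>i<m. e (m - i) * succession_tail m (Suc i)) =
      (\<Sum>i<m. (1 / (real m - real i) - 1 / real m) * succession_tail m (Suc i))" if m: "m \<ge> 1" for m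
  proof -
    have "1 = (\<Sum>i<m. (enn2real (mu (Suc (m - i))) - enn2real (mu (m - i))) * succession_tail m (Suc i))"
      by (rule mu_increments[OF m, symmetric])
    also have "\<dots> = (\<Sum>i<m. (1 + 1 / (real m - real i) - e (m - i)) * succession_tail m (Suc i))"
      by (intro sum.cong refl) (simp add: incr of_nat_diff)
    \<comment> \<open>Splitting \<open>1 / (m - i)\<close> into \<open>1 / m\<close> and the drift
      isolates a multiple of E[S], and \<open>(1 + 1 / m) * (m / (m + 1)) = 1\<close> cancels the
      left side.\<close>
    also have "\<dots> = (1 + 1 / real m) * (\<Sum>i<m. succession_tail m (Suc i)) +
        (\<Sum>i<m. (1 / (real m - real i) - 1 / real m) * succession_tail m (Suc i)) -
        (\<Sum>i<m. e (m - i) * succession_tail m (Suc i))"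
      unfolding sum_distrib_left sum.distrib[symmetric] sum_subtractf[symmetric]
      by (intro sum.cong refl) (simp add: algebra_simps)
    also have "(1 + 1 / real m) * (\<Sum>i<m. succession_tail m (Suc i)) = 1"
    proof -
      have "1 + 1 / real m = real (Suc m) / real m" using m by (simp add: field_simps)
      then show ?thesis unfolding sum_tail_mean using m by simp
    qed
    finally show ?thesis by simp
  qed
  \<comment> \<open>For \<open>m = 1\<close> the only coefficient on the right of
    \<open>balance\<close> vanishes; hence the induction starts at 2.\<close>
  have e1: "e 1 = 0"
    using balance[of 1] succession_tail_1_pos[of 1] by simp
  have bounds: "0 < e m \<and> e m < 1 / (real m)\<^sup>2" if "m \<ge> 2" for m
    using that
  proof (induction m rule: less_induct)
    case (less m)
    let ?Q = "\<lambda>i. succession_tail m (Suc i)"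
    let ?R = "\<Sum>i<m. (1 / (real m - real i) - 1 / real m) * ?Q i"
    have "{..<m} = insert 0 (insert (m - 1) {1..<m - 1})" using less.prems by auto
    then have "(\<Sum>i<m. e (m - i) * ?Q i) = e m * ?Q 0 + (\<Sum>i\<in>{1..<m - 1}. e (m - i) * ?Q i)"
      using less.prems e1 by (simp add: sum.insert)
    then have eq: "e m * ?Q 0 = ?R - (\<Sum>i\<in>{1..<m - 1}. e (m - i) * ?Q i)"
      using balance[of m] less.prems by simp
    have mid: "0 < e (m - i) \<and> e (m - i) < 1 / (real m - real i)\<^sup>2" if "i \<in> {1..<m - 1}" for i
    proof -
      have "m - i < m" "2 \<le> m - i" "real (m - i) = real m - real i" using that by auto
      then show ?thesis using less.IH[of "m - i"] by simp
    qed
    have Q0: "?Q 0 > 0" using succession_tail_1_pos[of m] less.prems by simp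
    have "0 \<le> (\<Sum>i\<in>{1..<m - 1}. e (m - i) * ?Q i)"
      using mid by (intro sum_nonneg mult_nonneg_nonneg) (auto intro: less_imp_le)
    then have "e m * ?Q 0 < 1 / (real m)\<^sup>2 * ?Q 0"
      using drift_upper[OF less.prems] unfolding eq by simp
    moreover have "(\<Sum>i\<in>{1..<m - 1}. e (m - i) * ?Q i) \<le> (\<Sum>i\<in>{1..<m - 1}. 1 / (real m - real i)\<^sup>2 * ?Q i)"
      using mid by (intro sum_mono mult_right_mono) (auto intro: less_imp_le)
    then have "0 < e m * ?Q 0"
      using drift_lower[OF less.prems] unfolding eq by simp
    ultimately have "0 < e m" "e m < 1 / (real m)\<^sup>2"
      using Q0 mult_right_less_imp_less[of "e m" "?Q 0" "1 / (real m)\<^sup>2"]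
      by (auto simp only: zero_less_mult_iff)
    then show ?case by simp
  qed
  have "decseq (\<lambda>n. \<epsilon> (n + 2))"
  proof (rule decseq_SucI)
    show "\<epsilon> (Suc n + 2) \<le> \<epsilon> (n + 2)" for n
      using bounds[of "n + 2"] by (simp add: e_def)
  qed
  moreover have "\<epsilon> 2 - 1 \<le> \<epsilon> (n + 2)" for n
  proof -
    \<comment> \<open>The extra term \<open>1 / (n + 1)\<close> lets the induction close: its
      decrease pays for \<open>1 / (n + 2)^2\<close>.\<close>
    have "\<epsilon> 2 - 1 + 1 / (real n + 1) \<le> \<epsilon> (n + 2)"
    proof (induction n)
      case (Suc n)
      have "1 / (real n + 2)\<^sup>2 \<le> 1 / (real n + 1) - 1 / (real n + 2)"
        by (simp add: divide_simps power2_eq_square)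
      moreover have "\<epsilon> (n + 2) - \<epsilon> (Suc n + 2) < 1 / (real n + 2)\<^sup>2"
        using bounds[of "n + 2"] by (simp add: e_def add.commute)
      ultimately show ?case using Suc by (simp add: add.commute)
    qed (simp add: numeral_2_eq_2)
    moreover have "0 \<le> 1 / (real n + 1)" by simp
    ultimately show ?thesis by linarith
  qed
  ultimately obtain L where "(\<lambda>n. \<epsilon> (n + 2)) \<longlonglongrightarrow> L" using decseq_convergent by blast
  then have "convergent \<epsilon>" by (auto simp only: convergent_def dest: LIMSEQ_offset)
  then show ?thesis using bounds mu_finite by (simp add: e_def)
qed

end
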